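(* Let $A\in\mathbb{R}^{n\times n}$, $B\in\mathbb{R}^{n\times m}$, $E\in\mathbb{R}^{m\times n}_+$ with no zero row, $s\in\mathbb{R}^n$ and $r\in\mathbb{R}^m$ be such that $A-|B|E$ is Metzler and $s\ge E^{\top}|r|$. If the linear program $$\text{maximize } \mathbf{1}^{\top}p \ \text{ over } p\in\mathbb{R}^n_+,\ \zeta\in\mathbb{R}^m_+ \quad\text{subject to } A^{\top}p\ge E^{\top}\zeta-s,\quad -\zeta\le r+B^{\top}p\le\zeta$$ has a bounded value, then the optimizer $p$ solves the equation $$0=s+A^{\top}p-E^{\top}\left|r+B^{\top}p\right|.$$
   Context: Inequalities between vectors or matrices are elementwise, $|X|$ denotes the elementwise absolute value, and $\mathbb{R}^n_+$, $\mathbb{R}^{m\times n}_+$ denote vectors/matrices with nonnegative entries. $\mathbf{1}$ is the all-ones vector. A square matrix is Metzler if its off-diagonal entries are nonnegative. "The optimizer $p$" means the $p$-component of an optimal pair $(p,\zeta)$. *)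

theory Defs
  imports "HOL-Analysis.Analysis"
begin

definition metzler :: "real^'n^'n \<Rightarrow> bool" where
  "metzler M \<longleftrightarrow> (\<forall>i j. i \<noteq> j \<longrightarrow> 0 \<le> M $ i $ j)"

(* On the type vec, and hence on matrices as vectors of rows, the library's orders and
   absolute value are elementwise, and 1 is the all-ones vector. *)

definition lp_feasible ::
  "real^'n^'n \<Rightarrow> real^'m^'n \<Rightarrow> real^'n^'m \<Rightarrow> real^'n \<Rightarrow> real^'m \<Rightarrow> ((real^'n) \<times> (real^'m)) set" where
  "lp_feasible A B E s r =
     {(p, \<zeta>). 0 \<le> p \<and> 0 \<le> \<zeta> \<and>
       transpose A *v p \<ge> transpose E *v \<zeta> - s \<and>
       - \<zeta> \<le> r + transpose B *v p \<and> r + transpose B *v p \<le> \<zeta>}"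

definition lp_objective :: "(real^'n) \<times> (real^'m) \<Rightarrow> real" where
  "lp_objective = (\<lambda>(p, \<zeta>). 1 \<bullet> p)"

definition lp_optimal ::
  "real^'n^'n \<Rightarrow> real^'m^'n \<Rightarrow> real^'n^'m \<Rightarrow> real^'n \<Rightarrow> real^'m \<Rightarrow> real^'n \<Rightarrow> real^'m \<Rightarrow> bool" where
  "lp_optimal A B E s r p \<zeta> \<longleftrightarrow>
     is_arg_max lp_objective (\<lambda>x. x \<in> lp_feasible A B E s r) (p, \<zeta>)"

end

theory Submission
  imports Defs
begin

text \<open>
  Since \<open>E\<close> is nonnegative, \<open>\<zeta> = \<bar>r + B\<^sup>T p\<bar>\<close> is the best choice of \<open>\<zeta>\<close>, so \<open>p \<ge> 0\<close> is feasible iff the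
  residual \<open>F p = s + A\<^sup>T p - E\<^sup>T \<bar>r + B\<^sup>T p\<bar>\<close> is nonnegative. These \<open>p\<close> form a closed set containing
  \<open>0\<close>, and a bound on the sum of their entries makes it compact, so an optimizer exists. If \<open>p\<close> is
  feasible with \<open>F p\<close> positive in entry \<open>j\<close>, then the Metzler condition says that increasing \<open>p\<^sub>j\<close> does
  not decrease the other entries of \<open>F p\<close>; a small increase therefore stays feasible and improves
  the objective.
\<close>

definition residual ::
  "real^'n^'n \<Rightarrow> real^'m^'n \<Rightarrow> real^'n^'m \<Rightarrow> real^'n \<Rightarrow> real^'m \<Rightarrow> real^'n \<Rightarrow> real^'n" where
  "residual A B E s r p = s + transpose A *v p - transpose E *v \<bar>r + transpose B *v p\<bar>"

lemma matrix_vector_mult_mono: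
  fixes M :: "real^'n^'m"
  assumes "0 \<le> M" "x \<le> y"
  shows "M *v x \<le> M *v y"
  using assms
  by (auto simp: less_eq_vec_def matrix_vector_mult_def intro!: sum_mono mult_left_mono)

lemma transpose_nonneg:
  fixes M :: "real^'n^'m"
  assumes "0 \<le> M"
  shows "0 \<le> transpose M"
  using assms by (simp add: less_eq_vec_def transpose_def)

text \<open>The two bounds on \<open>\<zeta>\<close> together say that it dominates
  \<open>\<bar>r + transpose B *v p\<bar>\<close>. As \<open>E\<close> is nonnegative,
  \<open>transpose E\<close> preserves this inequality, so replacing \<open>\<zeta>\<close> by the
  absolute value only relaxes the main constraint.\<close>

lemma residual_nonneg_if_feasible:
  assumes "0 \<le> E" "(p, \<zeta>) \<in> lp_feasible A B E s r"
  shows "0 \<le> p" "0 \<le> residual A B E s r p"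
proof -
  have f: "0 \<le> p" "transpose E *v \<zeta> - s \<le> transpose A *v p"
    "- \<zeta> \<le> r + transpose B *v p" "r + transpose B *v p \<le> \<zeta>"
    using assms(2) by (auto simp: lp_feasible_def)
  show "0 \<le> p" by (fact f)
  have "\<bar>r + transpose B *v p\<bar> \<le> \<zeta>"
    using f(3,4) unfolding less_eq_vec_def abs_vec_def
    by (simp add: abs_le_iff) (smt (verit))
  then have "transpose E *v \<bar>r + transpose B *v p\<bar> \<le> transpose E *v \<zeta>"
    by (intro matrix_vector_mult_mono transpose_nonneg assms)
  with f(2) show "0 \<le> residual A B E s r p"
    unfolding residual_def less_eq_vec_def
    by (smt (verit) vector_add_component vector_minus_component zero_index)
qed

lemma feasible_if_residual_nonneg:
  assumes "0 \<le> p" "0 \<le> residual A B E s r p"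
  shows "(p, \<bar>r + transpose B *v p\<bar>) \<in> lp_feasible A B E s r"
  using assms unfolding lp_feasible_def residual_def
  by (auto simp: less_eq_vec_def abs_vec_def algebra_simps)

lemma objective_eq_sum: "lp_objective (p, \<zeta>) = (\<Sum>i\<in>UNIV. p $ i)"
  by (simp add: lp_objective_def inner_vec_def)

lemma continuous_on_residual: "continuous_on S (residual A B E s r)"
proof -
  have "continuous_on S (\<lambda>p. \<bar>r + transpose B *v p\<bar>)"
    unfolding abs_vec_def by (intro continuous_intros)
  then show ?thesis
    unfolding residual_def
    by (intro continuous_intros bounded_linear.continuous_on[OF matrix_vector_mul_bounded_linear])
qed

lemma lp_optimal_exists:
  fixes A :: "real^'n^'n" and E :: "real^'n^'m"
  assumes "0 \<le> E" "transpose E *v \<bar>r\<bar> \<le> s"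
    and "bdd_above (lp_objective ` lp_feasible A B E s r)"
  shows "\<exists>p \<zeta>. lp_optimal A B E s r p \<zeta>"
proof -
  define S where "S = {p. 0 \<le> p \<and> 0 \<le> residual A B E s r p}"
  obtain M where M: "\<And>x. x \<in> lp_feasible A B E s r \<Longrightarrow> lp_objective x \<le> M"
    using assms(3) by (auto simp: bdd_above_def)
  \<comment> \<open>Each entry of a nonnegative vector is at most the sum of its entries, so the
    bound \<open>M\<close> on the objective bounds every entry.\<close>
  have "S \<subseteq> {0..(\<chi> i. M)}"
  proof
    fix p assume p: "p \<in> S"
    then have "(\<Sum>i\<in>UNIV. p $ i) \<le> M"
      using M[OF feasible_if_residual_nonneg[of p A B E s r]] by (simp add: S_def objective_eq_sum)
    moreover have "p $ i \<le> (\<Sum>i\<in>UNIV. p $ i)" for i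
      using p by (intro member_le_sum) (auto simp: S_def less_eq_vec_def)
    ultimately show "p \<in> {0..(\<chi> i. M)}"
      using p by (auto simp: S_def less_eq_vec_def intro: order_trans)
  qed
  then have "bounded S"
    by (metis bounded_cbox bounded_subset interval_cbox)
  moreover have "closed S"
    unfolding S_def less_eq_vec_def
    by (intro closed_Collect_conj closed_Collect_all closed_Collect_le continuous_intros
        continuous_on_residual)
  ultimately have "compact S"
    by (simp add: compact_eq_bounded_closed)
  \<comment> \<open>At \<open>0\<close> the residual is
    \<open>s - transpose E *v \<bar>r\<bar>\<close>, so the assumption on \<open>s\<close> makes
    \<open>S\<close> nonempty.\<close>
  moreover have "0 \<in> S"
    using assms(2) by (simp add: S_def residual_def)
  ultimately obtain p where p: "p \<in> S" "\<And>q. q \<in> S \<Longrightarrow> (\<Sum>i\<in>UNIV. q $ i) \<le> (\<Sum>i\<in>UNIV. p $ i)"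
    using continuous_attains_sup[of S "\<lambda>p. \<Sum>i\<in>UNIV. p $ i"]
    by (force intro: continuous_intros)
  have "(p, \<bar>r + transpose B *v p\<bar>) \<in> lp_feasible A B E s r"
    using p(1) by (intro feasible_if_residual_nonneg) (auto simp: S_def)
  \<comment> \<open>The objective ignores \<open>\<zeta>\<close>, so a maximum over the projection
    \<open>S\<close> is a maximum of the linear program.\<close>
  moreover have "q \<in> S" if "(q, \<zeta>) \<in> lp_feasible A B E s r" for q \<zeta>
    using residual_nonneg_if_feasible[OF assms(1) that] by (simp add: S_def)
  ultimately have "lp_optimal A B E s r p \<bar>r + transpose B *v p\<bar>"
    using p(2) by (fastforce simp: lp_optimal_def is_arg_max_linorder objective_eq_sum)
  then show ?thesis by blast
qed

text \<open>The step adds \<open>e\<close> times row \<open>j\<close> of \<open>A\<close> to the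
  linear part. By the triangle inequality, the absolute value grows by at most \<open>e\<close>
  times row \<open>j\<close> of \<open>\<bar>B\<bar>\<close>, and multiplying by the nonnegative
  \<open>transpose E\<close> keeps this bound.\<close>

lemma residual_add_axis_ge:
  fixes A :: "real^'n^'n" and E :: "real^'n^'m"
  assumes "0 \<le> E" "0 \<le> e"
  shows "residual A B E s r p $ i + e * (A - \<bar>B\<bar> ** E) $ j $ i
    \<le> residual A B E s r (p + axis j e) $ i"
proof -
  \<comment> \<open>The column count of \<open>M\<close> is left generic so that the identity serves
    both \<open>A\<close> and \<open>B\<close>.\<close>
  have ax: "(transpose M *v (p + axis j e)) $ k = (transpose M *v p) $ k + e * M $ j $ k"
    for M :: "real^'k^'n" and k
    by (simp add: matrix_vector_mult_def transpose_def axis_def distrib_left sum.distrib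
        if_distrib[of "(*) _"] mult.commute[of e] cong: if_cong)
  have "(transpose E *v \<bar>r + transpose B *v (p + axis j e)\<bar>) $ i
      = (\<Sum>k\<in>UNIV. E $ k $ i * \<bar>r $ k + (transpose B *v p) $ k + e * B $ j $ k\<bar>)"
    unfolding matrix_vector_mult_def[of "transpose E"]
    by (simp add: abs_vec_def ax transpose_def[of E] add.assoc del: transpose_matrix_vector)
  also have "\<dots> \<le> (\<Sum>k\<in>UNIV. E $ k $ i * (\<bar>r $ k + (transpose B *v p) $ k\<bar> + e * \<bar>B $ j $ k\<bar>))"
  proof (intro sum_mono mult_left_mono)
    fix k
    show "\<bar>r $ k + (transpose B *v p) $ k + e * B $ j $ k\<bar>
        \<le> \<bar>r $ k + (transpose B *v p) $ k\<bar> + e * \<bar>B $ j $ k\<bar>"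
      using abs_triangle_ineq[of "r $ k + (transpose B *v p) $ k" "e * B $ j $ k"] assms(2)
      by (simp add: abs_mult)
    show "0 \<le> E $ k $ i"
      using assms(1) by (simp add: less_eq_vec_def)
  qed
  also have "\<dots> = (transpose E *v \<bar>r + transpose B *v p\<bar>) $ i + e * (\<bar>B\<bar> ** E) $ j $ i"
    unfolding matrix_vector_mult_def[of "transpose E"]
    by (simp add: abs_vec_def transpose_def[of E] matrix_matrix_mult_def sum.distrib
        sum_distrib_left algebra_simps del: transpose_matrix_vector)
  finally show ?thesis
    by (simp add: residual_def ax right_diff_distrib del: transpose_matrix_vector)
qed

lemma residual_eq_0_if_optimal:
  fixes A :: "real^'n^'n" and E :: "real^'n^'m"
  assumes E: "0 \<le> E" and metz: "metzler (A - \<bar>B\<bar> ** E)"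
    and opt: "lp_optimal A B E s r p \<zeta>"
  shows "residual A B E s r p = 0"
proof (rule ccontr)
  let ?F = "residual A B E s r"
  have feas: "(p, \<zeta>) \<in> lp_feasible A B E s r"
    and max: "\<And>x. x \<in> lp_feasible A B E s r \<Longrightarrow> lp_objective x \<le> lp_objective (p, \<zeta>)"
    using opt by (auto simp: lp_optimal_def is_arg_max_linorder)
  note p = residual_nonneg_if_feasible[OF E feas]
  assume "?F p \<noteq> 0"
  then obtain j where j: "0 < ?F p $ j"
    using p(2) by (auto simp: vec_eq_iff less_eq_vec_def order_less_le)
  let ?c = "(A - \<bar>B\<bar> ** E) $ j $ j"
  \<comment> \<open>The Metzler condition leaves the sign of the diagonal entry \<open>?c\<close>
    open. This step size makes \<open>e * \<bar>?c\<bar>\<close> at most \<open>?F p $ j\<close>, so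
    entry \<open>j\<close> stays nonnegative; the summand 1 keeps the denominator positive.\<close>
  define e where "e = ?F p $ j / (1 + \<bar>?c\<bar>)"
  have e: "0 < e"
    using j by (simp add: e_def)
  have ec: "0 \<le> ?F p $ j + e * ?c"
  proof -
    have "- ?F p $ j = - (e * (1 + \<bar>?c\<bar>))"
      by (simp add: e_def)
    also have "\<dots> \<le> e * ?c"
      using e mult_left_mono[of "- (1 + \<bar>?c\<bar>)" ?c e] by (simp add: algebra_simps)
    finally show ?thesis by simp
  qed
  have "0 \<le> ?F p $ i + e * (A - \<bar>B\<bar> ** E) $ j $ i" for i
  proof (cases "i = j")
    case True
    then show ?thesis using ec by simp
  next
    case False
    then have "0 \<le> (A - \<bar>B\<bar> ** E) $ j $ i"
      using metz unfolding metzler_def by metis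
    then show ?thesis
      using e p(2) by (simp add: less_eq_vec_def del: vector_minus_component)
  qed
  then have "0 \<le> ?F (p + axis j e)"
    using residual_add_axis_ge[OF E, of e] e unfolding less_eq_vec_def zero_index
    by (meson less_imp_le order_trans)
  moreover have "0 \<le> p + axis j e"
    using p(1) e by (simp add: less_eq_vec_def axis_def)
  ultimately have "lp_objective (p + axis j e, \<bar>r + transpose B *v (p + axis j e)\<bar>)
      \<le> lp_objective (p, \<zeta>)"
    by (intro max feasible_if_residual_nonneg)
  \<comment> \<open>The objective at the new point exceeds the old one by exactly
    \<open>e\<close>.\<close>
  then show False
    using e by (simp add: objective_eq_sum sum.distrib axis_def)
qed

theorem theorem11:
  fixes A :: "real^'n^'n" and B :: "real^'m^'n" and E :: "real^'n^'m"
    and s :: "real^'n" and r :: "real^'m"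
  assumes "0 \<le> E"
    and "\<forall>i. row i E \<noteq> 0"
    and "metzler (A - \<bar>B\<bar> ** E)"
    and "s \<ge> transpose E *v \<bar>r\<bar>"
    and "bdd_above (lp_objective ` lp_feasible A B E s r)"
  shows "(\<exists>p \<zeta>. lp_optimal A B E s r p \<zeta>) \<and>
    (\<forall>p \<zeta>. lp_optimal A B E s r p \<zeta> \<longrightarrow>
      0 = s + transpose A *v p - transpose E *v \<bar>r + transpose B *v p\<bar>)"
  using lp_optimal_exists[OF assms(1,4,5)] residual_eq_0_if_optimal[OF assms(1,3)]
  unfolding residual_def by metis

end
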